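(* Let $\mathrm{cl}$ be a coding length on subsets of $\mathcal I=\{1,\ldots,p\}$, with associated coding complexity $c(\cdot)$. Suppose that the entries of $X\in\mathbb R^{n\times p}$ are iid standard Gaussian $N(0,1)$. Let $s>0$, $t>0$ and $\delta\in(0,1)$, and suppose \[ n\ge \frac{8}{\delta^2}\left[\ln 3+t+s\ln(1+8/\delta)\right]. \] Then with probability at least $1-e^{-t}$, the random matrix $X$ satisfies \[ (1-\delta)\|\bar\beta\|_2\le \frac{1}{\sqrt n}\|X\bar\beta\|_2\le (1+\delta)\|\bar\beta\|_2 \] simultaneously for all vectors $\bar\beta\in\mathbb R^p$ with coding complexity $c(\bar\beta)\le s$.
   Context: Let $\mathcal I=\{1,\ldots,p\}$. A function $\mathrm{cl}$ from subsets of $\mathcal I$ to $[0,\infty]$ is a coding length if $\sum_{F\subset\mathcal I,\,F\ne\emptyset}2^{-\mathrm{cl}(F)}\le 1$, with $\mathrm{cl}(\emptyset)=0$. The coding complexity of $F\subset\mathcal I$ is $c(F)=|F|+\mathrm{cl}(F)$, and for $\beta\in\mathbb R^p$, $c(\beta)=\min\{c(F): \mathrm{supp}(\beta)\subset F\}$, where $\mathrm{supp}(\beta)=\{j:\beta_j\neq 0\}$. *)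

theory Defs
  imports "HOL-Probability.Probability"
begin

definition coding_length :: "nat \<Rightarrow> (nat set \<Rightarrow> ereal) \<Rightarrow> bool" where
  "coding_length p cl \<longleftrightarrow>
     cl {} = 0 \<and> (\<forall>F\<subseteq>{1..p}. cl F \<ge> 0) \<and>
     (\<Sum>F\<in>{F. F \<subseteq> {1..p} \<and> F \<noteq> {}}.
        (if cl F = \<infinity> then 0 else (2::real) powr (- real_of_ereal (cl F)))) \<le> 1"

definition coding_complexity_set :: "(nat set \<Rightarrow> ereal) \<Rightarrow> nat set \<Rightarrow> ereal" where
  "coding_complexity_set cl F = ereal (real (card F)) + cl F"

definition supp :: "nat \<Rightarrow> (nat \<Rightarrow> real) \<Rightarrow> nat set" where
  "supp p \<beta> = {j \<in> {1..p}. \<beta> j \<noteq> 0}"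

definition coding_complexity :: "nat \<Rightarrow> (nat set \<Rightarrow> ereal) \<Rightarrow> (nat \<Rightarrow> real) \<Rightarrow> ereal" where
  "coding_complexity p cl \<beta> =
     Min (coding_complexity_set cl ` {F. F \<subseteq> {1..p} \<and> supp p \<beta> \<subseteq> F})"

text \<open>Vectors in R^p: functions nat => real vanishing outside {1..p}.\<close>
definition l2norm :: "nat \<Rightarrow> (nat \<Rightarrow> real) \<Rightarrow> real" where
  "l2norm p \<beta> = sqrt (\<Sum>j\<in>{1..p}. (\<beta> j)\<^sup>2)"

definition matvec :: "nat \<Rightarrow> ((nat \<times> nat) \<Rightarrow> real) \<Rightarrow> (nat \<Rightarrow> real) \<Rightarrow> nat \<Rightarrow> real" where
  "matvec p X \<beta> = (\<lambda>i. \<Sum>j\<in>{1..p}. X (i, j) * \<beta> j)"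

definition gaussian_matrix :: "nat \<Rightarrow> nat \<Rightarrow> ((nat \<times> nat) \<Rightarrow> real) measure" where
  "gaussian_matrix n p = (\<Pi>\<^sub>M ij\<in>{1..n}\<times>{1..p}. density lborel std_normal_density)"

end

(*
  Fix a nonempty F of coding complexity at most s. A (delta/4)-net of the unit sphere of R^F has at
  most (1 + 8/delta)^|F| points by volume comparison. For a unit vector u the entries of X u are iid
  N(0,1), so the Chernoff bound for the chi-square distribution gives | |X u|/sqrt n - 1 | <= delta/2
  except with probability 2 exp(-n delta^2/8). Closeness on the net to within delta/2 forces
  closeness on all of R^F to within delta. The lower bound on n makes the failure probability for F
  at most exp(-t) (1 + 8/delta)^(|F| - s) <= exp(-t) 2^(-cl F), and the coding length condition is
  what makes these sum to at most exp(-t).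
*)
theory Submission
  imports Defs
begin

section \<open>Nets on Euclidean spheres\<close>

text \<open>Points are members of the product space, hence \<open>undefined\<close> off
  \<open>F\<close>, so that the ball is a measurable set of \<open>PiM\<close>. The centre
  \<open>a\<close> may be any function, since only its values on \<open>F\<close> enter.\<close>

definition l2_ball :: "'i set \<Rightarrow> ('i \<Rightarrow> real) \<Rightarrow> real \<Rightarrow> ('i \<Rightarrow> real) set" where
  "l2_ball F a r = {x \<in> space (PiM F (\<lambda>_. lborel)). L2_set (\<lambda>i. x i - a i) F < r}"

lemma borel_measurable_L2_set [measurable]:
  assumes "\<And>i. i \<in> F \<Longrightarrow> f i \<in> borel_measurable M"
  shows "(\<lambda>x. L2_set (\<lambda>i. f i x) F) \<in> borel_measurable M"
  using assms unfolding L2_set_def by measurable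

lemma sets_l2_ball [measurable]: "l2_ball F a r \<in> sets (PiM F (\<lambda>_. lborel))"
  unfolding l2_ball_def by measurable

text \<open>A product measure is determined by its values on boxes, and on a box the substitution x
  -> a + r x contributes one factor \<open>r\<close> per coordinate.\<close>

lemma PiM_lborel_affine:
  fixes a :: "'i \<Rightarrow> real"
  assumes F: "finite F" and r: "0 < r"
  shows "PiM F (\<lambda>_. lborel) = scale_measure (ennreal r ^ card F)
           (distr (PiM F (\<lambda>_. lborel)) (PiM F (\<lambda>_. lborel)) (\<lambda>x. \<lambda>i\<in>F. a i + r * x i))"
    (is "?M = scale_measure _ (distr _ _ ?T)")
proof -
  interpret product_sigma_finite "\<lambda>_::'i. lborel :: real measure"
    by standard
  have T: "?T \<in> measurable ?M ?M" by measurable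
  show ?thesis
  proof (rule PiM_eqI[OF F, symmetric])
    fix A :: "'i \<Rightarrow> real set" assume A: "\<And>i. i \<in> F \<Longrightarrow> A i \<in> sets lborel"
    have vimage: "?T -` Pi\<^sub>E F A \<inter> space ?M = Pi\<^sub>E F (\<lambda>i. (\<lambda>x. a i + r * x) -` A i)"
      by (auto simp: space_PiM PiE_iff)
    have sets: "(\<lambda>x. a i + r * x) -` A i \<in> sets lborel" if "i \<in> F" for i
    proof -
      have "(\<lambda>x. a i + r * x) \<in> measurable lborel borel" by measurable
      from measurable_sets[OF this, of "A i"] A[OF that] show ?thesis by simp
    qed
    have scale: "emeasure lborel (A i) = ennreal r * emeasure lborel ((\<lambda>x. a i + r * x) -` A i)"
      if "i \<in> F" for i
    proof -
      have "emeasure lborel (A i) = (\<integral>\<^sup>+x. indicator (A i) x \<partial>lborel)"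
        using A that by simp
      also have "\<dots> = r * (\<integral>\<^sup>+x. indicator (A i) (a i + r * x) \<partial>lborel)"
        using A[OF that] r by (subst nn_integral_real_affine[where c=r and t="a i"]) auto
      also have "(\<integral>\<^sup>+x. indicator (A i) (a i + r * x) \<partial>lborel)
          = (\<integral>\<^sup>+x. indicator ((\<lambda>x. a i + r * x) -` A i) x \<partial>lborel)"
        by (simp add: indicator_def)
      also have "\<dots> = emeasure lborel ((\<lambda>x. a i + r * x) -` A i)"
        using sets[OF that] by simp
      finally show ?thesis .
    qed
    show "emeasure (scale_measure (ennreal r ^ card F) (distr ?M ?M ?T)) (Pi\<^sub>E F A)
        = (\<Prod>i\<in>F. emeasure lborel (A i))"
      using A F by (simp add: emeasure_distr[OF T] vimage emeasure_PiM[OF F] sets[simplified]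
          scale prod.distrib sets_PiM_I_finite cong: prod.cong)
  qed (use F in auto)
qed

text \<open>The map x -> a + r x pulls the ball of radius \<open>r\<close> about \<open>a\<close>
  back to the unit ball, so the change of variables applies.\<close>

lemma emeasure_l2_ball:
  assumes F: "finite F" and r: "0 < r"
  shows "emeasure (PiM F (\<lambda>_. lborel)) (l2_ball F a r)
       = ennreal r ^ card F * emeasure (PiM F (\<lambda>_. lborel)) (l2_ball F (\<lambda>_. 0) 1)"
proof -
  let ?M = "PiM F (\<lambda>_. lborel :: real measure)"
  let ?T = "\<lambda>x. \<lambda>i\<in>F. a i + r * x i"
  have T: "?T \<in> measurable ?M ?M" by measurable
  have "L2_set (\<lambda>i. r * x i) F < r \<longleftrightarrow> L2_set x F < 1" for x
    using r by (simp flip: L2_set_right_distrib)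
  then have "?T -` l2_ball F a r \<inter> space ?M = l2_ball F (\<lambda>_. 0) 1"
    by (auto simp: l2_ball_def space_PiM cong: L2_set_cong)
  then show ?thesis
    by (subst PiM_lborel_affine[OF F r, of a]) (simp add: emeasure_distr[OF T])
qed

text \<open>The unit ball is squeezed between two cubes. These two facts allow its volume to be
  cancelled in the packing bound.\<close>

lemma emeasure_l2_ball_unit:
  assumes F: "finite F"
  shows "0 < emeasure (PiM F (\<lambda>_. lborel)) (l2_ball F (\<lambda>_. 0) 1)"
    and "emeasure (PiM F (\<lambda>_. lborel)) (l2_ball F (\<lambda>_. 0) 1) < \<infinity>"
proof -
  let ?M = "PiM F (\<lambda>_. lborel :: real measure)"
  interpret product_sigma_finite "\<lambda>_::'a. lborel :: real measure"
    by standard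
  have box: "emeasure ?M (Pi\<^sub>E F (\<lambda>_. {-c..c})) = ennreal (2 * c) ^ card F" if "0 < c" for c
    using that F by (subst emeasure_PiM) auto
  \<comment> \<open>The half-width is chosen so that the l1 norm on the cube, at most
    \<open>card F * c\<close>, stays strictly below 1; the added 1 gives strictness and keeps
    \<open>c\<close> positive for empty \<open>F\<close>.\<close>
  define c where "c = 1 / (real (card F) + 1)"
  have c: "0 < c" by (simp add: c_def)
  have "L2_set x F < 1" if "x \<in> Pi\<^sub>E F (\<lambda>_. {-c..c})" for x
  proof -
    have "L2_set x F \<le> (\<Sum>i\<in>F. \<bar>x i\<bar>)" by (rule L2_set_le_sum_abs)
    also have "\<dots> \<le> (\<Sum>i\<in>F. c)" using that by (intro sum_mono) (force simp: PiE_iff abs_le_iff)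
    also have "\<dots> < 1" by (simp add: c_def field_simps)
    finally show ?thesis .
  qed
  then have "Pi\<^sub>E F (\<lambda>_. {-c..c}) \<subseteq> l2_ball F (\<lambda>_. 0) 1"
    by (auto simp: l2_ball_def space_PiM)
  then have "emeasure ?M (Pi\<^sub>E F (\<lambda>_. {-c..c})) \<le> emeasure ?M (l2_ball F (\<lambda>_. 0) 1)"
    by (intro emeasure_mono) measurable
  moreover have "0 < ennreal (2 * c) ^ card F" using c by (simp add: ennreal_power)
  ultimately show "0 < emeasure ?M (l2_ball F (\<lambda>_. 0) 1)" using box[OF c] by simp
  have "x i \<in> {-1..1}" if "L2_set x F < 1" "i \<in> F" for x :: "'a \<Rightarrow> real" and i
  proof -
    have "\<bar>x i\<bar> \<le> L2_set (\<lambda>i. \<bar>x i\<bar>) F" using F that by (intro member_le_L2_set) auto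
    also have "L2_set (\<lambda>i. \<bar>x i\<bar>) F = L2_set x F" by (simp add: L2_set_def)
    finally show ?thesis using that by auto
  qed
  then have "l2_ball F (\<lambda>_. 0) 1 \<subseteq> Pi\<^sub>E F (\<lambda>_. {-1..1})"
    by (auto simp: l2_ball_def space_PiM PiE_iff extensional_def)
  then have "emeasure ?M (l2_ball F (\<lambda>_. 0) 1) \<le> emeasure ?M (Pi\<^sub>E F (\<lambda>_. {-1..1}))"
    using F by (intro emeasure_mono sets_PiM_I_finite) auto
  also have "\<dots> < \<infinity>" using box[of 1] by (simp add: ennreal_power less_top[symmetric] power_eq_top_ennreal)
  finally show "emeasure ?M (l2_ball F (\<lambda>_. 0) 1) < \<infinity>" .
qed

text \<open>Here vectors are 0 off \<open>F\<close>, unlike the extensional points of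
  \<open>l2_ball\<close>: they are meant as vectors of the full space supported in \<open>F\<close>,
  to which \<open>matvec\<close> applies directly.\<close>

definition l2_sphere :: "'i set \<Rightarrow> ('i \<Rightarrow> real) set" where
  "l2_sphere F = {u. (\<forall>i. i \<notin> F \<longrightarrow> u i = 0) \<and> L2_set u F = 1}"

lemma L2_set_minus_commute: "L2_set (\<lambda>i. x i - y i) F = L2_set (\<lambda>i. y i - x i) F"
  by (simp add: L2_set_def power2_commute)

lemma L2_set_triangle_ineq_diff:
  "L2_set (\<lambda>i. x i - z i) F \<le> L2_set (\<lambda>i. x i - y i) F + L2_set (\<lambda>i. y i - z i) F"
  using L2_set_triangle_ineq[of "\<lambda>i. x i - y i" "\<lambda>i. y i - z i" F] by simp

text \<open>Balls of radius \<eta>/2 about the points of \<open>Q\<close> are disjoint and lie in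
  the ball of radius 1 + \<eta>/2 about 0. Comparing volumes bounds \<open>card Q\<close> by the
  ratio of the radii to the power |F|.\<close>

lemma l2_sphere_packing:
  assumes F: "finite F" and \<eta>: "0 < \<eta>" and Q: "finite Q" "Q \<subseteq> l2_sphere F"
    and sep: "\<And>u v. u \<in> Q \<Longrightarrow> v \<in> Q \<Longrightarrow> u \<noteq> v \<Longrightarrow> \<eta> \<le> L2_set (\<lambda>i. u i - v i) F"
  shows "real (card Q) \<le> (1 + 2 / \<eta>) ^ card F"
proof -
  let ?M = "PiM F (\<lambda>_. lborel :: real measure)" and ?k = "card F"
  define V where "V = measure ?M (l2_ball F (\<lambda>_. 0) 1)"
  have V: "emeasure ?M (l2_ball F (\<lambda>_. 0) 1) = ennreal V" and V0: "0 < V"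
    using emeasure_l2_ball_unit[OF F] emeasure_eq_ennreal_measure[of ?M "l2_ball F (\<lambda>_. 0) 1"]
    unfolding V_def by (simp_all add: less_top measure_def enn2real_positive_iff)
  have ball: "emeasure ?M (l2_ball F a r) = ennreal (r ^ ?k * V)" if "0 < r" for a r
    using emeasure_l2_ball[OF F that, of a] that V0 by (simp add: V ennreal_power ennreal_mult)
  have disj: "disjoint_family_on (\<lambda>u. l2_ball F u (\<eta> / 2)) Q"
    unfolding disjoint_family_on_def
  proof (intro ballI impI equals0I)
    fix u v x assume uv: "u \<in> Q" "v \<in> Q" "u \<noteq> v"
      and x: "x \<in> l2_ball F u (\<eta> / 2) \<inter> l2_ball F v (\<eta> / 2)"
    have "L2_set (\<lambda>i. u i - v i) F \<le> L2_set (\<lambda>i. u i - x i) F + L2_set (\<lambda>i. x i - v i) F"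
      by (rule L2_set_triangle_ineq_diff)
    then show False
      using sep[OF uv] x by (simp add: l2_ball_def L2_set_minus_commute[of u x])
  qed
  have sub: "(\<Union>u\<in>Q. l2_ball F u (\<eta> / 2)) \<subseteq> l2_ball F (\<lambda>_. 0) (1 + \<eta> / 2)"
  proof safe
    fix u x assume u: "u \<in> Q" and x: "x \<in> l2_ball F u (\<eta> / 2)"
    have "L2_set u F = 1" using u Q by (auto simp: l2_sphere_def)
    then show "x \<in> l2_ball F (\<lambda>_. 0) (1 + \<eta> / 2)"
      using L2_set_triangle_ineq_diff[of x "\<lambda>_. 0" F u] x by (simp add: l2_ball_def)
  qed
  have "ennreal (card Q * ((\<eta> / 2) ^ ?k * V)) = (\<Sum>u\<in>Q. emeasure ?M (l2_ball F u (\<eta> / 2)))"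
    using \<eta> V0 by (simp add: ball ennreal_mult ennreal_of_nat_eq_real_of_nat)
  also have "\<dots> = emeasure ?M (\<Union>u\<in>Q. l2_ball F u (\<eta> / 2))"
    using Q disj by (intro sum_emeasure) auto
  also have "\<dots> \<le> emeasure ?M (l2_ball F (\<lambda>_. 0) (1 + \<eta> / 2))"
    by (intro emeasure_mono sub) measurable
  also have "\<dots> = ennreal ((1 + \<eta> / 2) ^ ?k * V)"
    using \<eta> by (intro ball) simp
  finally have "card Q * ((\<eta> / 2) ^ ?k * V) \<le> (1 + \<eta> / 2) ^ ?k * V"
    using \<eta> V0 by (subst (asm) ennreal_le_iff) auto
  then have "card Q * (\<eta> / 2) ^ ?k \<le> (1 + \<eta> / 2) ^ ?k"
    using V0 by (simp add: mult.assoc[symmetric])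
  also have "1 + \<eta> / 2 = (1 + 2 / \<eta>) * (\<eta> / 2)"
    using \<eta> by (simp add: field_simps)
  also have "\<dots> ^ ?k = (1 + 2 / \<eta>) ^ ?k * (\<eta> / 2) ^ ?k"
    by (rule power_mult_distrib)
  finally show ?thesis using \<eta> by simp
qed

text \<open>A separated set of largest cardinality is already a net, since a point farther than
  \<eta> from all its members could be added. The packing bound shows both that a largest one exists
  and that it is small.\<close>

lemma l2_sphere_net:
  assumes F: "finite F" and \<eta>: "0 < \<eta>"
  obtains Q where "finite Q" "Q \<subseteq> l2_sphere F" "real (card Q) \<le> (1 + 2 / \<eta>) ^ card F"
    "\<And>u. u \<in> l2_sphere F \<Longrightarrow> \<exists>v\<in>Q. L2_set (\<lambda>i. u i - v i) F \<le> \<eta>"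
proof -
  define sep where "sep Q \<longleftrightarrow> finite Q \<and> Q \<subseteq> l2_sphere F \<and>
    (\<forall>u\<in>Q. \<forall>v\<in>Q. u \<noteq> v \<longrightarrow> \<eta> \<le> L2_set (\<lambda>i. u i - v i) F)" for Q
  have bound: "real (card Q) \<le> (1 + 2 / \<eta>) ^ card F" if "sep Q" for Q
    using that F \<eta> by (intro l2_sphere_packing) (auto simp: sep_def)
  then have "card Q \<le> nat \<lfloor>(1 + 2 / \<eta>) ^ card F\<rfloor>" if "sep Q" for Q
    using that by (simp add: le_nat_floor)
  moreover have "sep {}" by (simp add: sep_def)
  ultimately obtain Q where Q: "sep Q" and max: "\<And>R. sep R \<Longrightarrow> card R \<le> card Q"
    using ex_has_greatest_nat[of sep "{}" card "Suc (nat \<lfloor>(1 + 2 / \<eta>) ^ card F\<rfloor>)"]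
    by (auto simp: less_Suc_eq_le)
  have "\<exists>v\<in>Q. L2_set (\<lambda>i. u i - v i) F \<le> \<eta>" if u: "u \<in> l2_sphere F" for u
  proof (rule ccontr)
    assume far: "\<not> ?thesis"
    have "u \<notin> Q" using far \<eta> by (auto simp: L2_set_def)
    moreover have "sep (insert u Q)"
      using Q u far unfolding sep_def by (auto simp: not_le L2_set_minus_commute[of _ u] intro: less_imp_le)
    ultimately show False using max[of "insert u Q"] Q by (simp add: sep_def)
  qed
  with Q bound show thesis by (intro that[of Q]) (auto simp: sep_def)
qed

text \<open>This works for any seminorm \<open>N\<close> and will be used for N x = |X x| / sqrt n.
  The supremum \<open>B\<close> of \<open>N\<close> over the sphere bounds the error of replacing a
  unit vector by a net point, which gives an inequality for \<open>B\<close> in terms of itself;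
  solving it yields the upper bound, and the upper bound yields the lower one.\<close>

lemma near_isometry_from_net:
  fixes N :: "('i \<Rightarrow> real) \<Rightarrow> real"
  assumes F: "finite F"
    and tri: "\<And>x y. N (\<lambda>i. x i + y i) \<le> N x + N y"
    and hom: "\<And>c x. N (\<lambda>i. c * x i) = \<bar>c\<bar> * N x"
    and bdd: "\<And>u. u \<in> l2_sphere F \<Longrightarrow> N u \<le> C"
    and \<delta>: "0 < \<delta>" "\<delta> < 1"
    and Q: "Q \<subseteq> l2_sphere F"
    and net: "\<And>u. u \<in> l2_sphere F \<Longrightarrow> \<exists>v\<in>Q. L2_set (\<lambda>i. u i - v i) F \<le> \<delta> / 4"
    and NQ: "\<And>u. u \<in> Q \<Longrightarrow> 1 - \<delta> / 2 \<le> N u \<and> N u \<le> 1 + \<delta> / 2"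
    and x: "\<And>i. i \<notin> F \<Longrightarrow> x i = 0"
  shows "(1 - \<delta>) * L2_set x F \<le> N x \<and> N x \<le> (1 + \<delta>) * L2_set x F"
proof (cases "L2_set x F = 0")
  case True
  have "x i = 0" for i using x True F by (cases "i \<in> F") (auto simp: L2_set_eq_0_iff)
  then have "x = (\<lambda>_. 0)" by blast
  then have "N x = 0" using hom[of 0 x] by simp
  then show ?thesis using True by simp
next
  case False
  have normalize: "\<exists>u\<in>l2_sphere F. N y = L2_set y F * N u"
    if "\<And>i. i \<notin> F \<Longrightarrow> y i = 0" "L2_set y F \<noteq> 0" for y
  proof -
    let ?l = "L2_set y F"
    have l: "0 < ?l" using that by (simp add: order_less_le)
    let ?u = "\<lambda>i. inverse ?l * y i"
    have "L2_set ?u F = inverse ?l * ?l" using l by (subst L2_set_right_distrib) auto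
    then have "?u \<in> l2_sphere F" using that l by (simp add: l2_sphere_def)
    moreover have "N y = ?l * N ?u" using hom[of "inverse ?l" y] l by (simp add: field_simps)
    ultimately show ?thesis by blast
  qed
  obtain u where u: "u \<in> l2_sphere F" and Nx: "N x = L2_set x F * N u"
    using normalize[OF x False] by auto
  \<comment> \<open>Boundedness by \<open>C\<close> makes this supremum finite, so that it can later
    be absorbed; the size of \<open>C\<close> does not enter the result.\<close>
  define B where "B = (SUP u\<in>l2_sphere F. N u)"
  have le_B: "N v \<le> B" if "v \<in> l2_sphere F" for v
    unfolding B_def using that bdd by (intro cSUP_upper) (auto intro!: bdd_aboveI2)
  \<comment> \<open>The triangle inequality for y and -y gives 0 = N 0 <= 2 N y.\<close>
  have N_nonneg: "0 \<le> N y" for y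
    using tri[of y "\<lambda>i. -1 * y i"] hom[of "-1" y] hom[of 0 y] by simp
  have B0: "0 \<le> B" using le_B[OF u] N_nonneg[of u] by linarith
  \<comment> \<open>The difference is rescaled to the sphere, where \<open>N\<close> is at most
    \<open>B\<close>. A zero difference cannot be rescaled and is treated apart.\<close>
  have near: "N (\<lambda>i. v i - w i) \<le> B * \<delta> / 4"
    if "v \<in> l2_sphere F" "w \<in> l2_sphere F" "L2_set (\<lambda>i. v i - w i) F \<le> \<delta> / 4" for v w
  proof (cases "L2_set (\<lambda>i. v i - w i) F = 0")
    case True
    have "v i - w i = 0" for i
      using that True F by (cases "i \<in> F") (auto simp: L2_set_eq_0_iff l2_sphere_def)
    then have "N (\<lambda>i. v i - w i) = 0" using hom[of 0 v] by simp
    then show ?thesis using B0 \<delta> by simp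
  next
    case False
    have "v i - w i = 0" if "i \<notin> F" for i
      using that \<open>v \<in> l2_sphere F\<close> \<open>w \<in> l2_sphere F\<close> by (simp add: l2_sphere_def)
    then obtain z where z: "z \<in> l2_sphere F" "N (\<lambda>i. v i - w i) = L2_set (\<lambda>i. v i - w i) F * N z"
      using normalize[of "\<lambda>i. v i - w i"] False by auto
    note z(2)
    also have "L2_set (\<lambda>i. v i - w i) F * N z \<le> \<delta> / 4 * B"
      using that le_B[OF z(1)] N_nonneg[of z] \<delta> by (intro mult_mono) auto
    finally show ?thesis by (simp add: mult.commute)
  qed
  have "N v \<le> (1 + \<delta> / 2) + B * \<delta> / 4" if v: "v \<in> l2_sphere F" for v
  proof -
    obtain w where w: "w \<in> Q" "L2_set (\<lambda>i. v i - w i) F \<le> \<delta> / 4" using net[OF v] by auto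
    then show ?thesis using tri[of w "\<lambda>i. v i - w i"] near[OF v, of w] NQ[of w] Q by auto
  qed
  then have "B \<le> (1 + \<delta> / 2) + B * \<delta> / 4"
    unfolding B_def using u by (intro cSUP_least) auto
  then have "B * (1 - \<delta> / 4) \<le> 1 + \<delta> / 2" by (simp add: algebra_simps)
  \<comment> \<open>The two sides differ by \<delta>(1 - \<delta>)/4, which is where \<delta> < 1
    enters.\<close>
  also have "\<dots> \<le> (1 + \<delta>) * (1 - \<delta> / 4)"
  proof -
    have "\<delta> * \<delta> \<le> \<delta> * 1" using \<delta> by (intro mult_left_mono) auto
    moreover have "(1 + \<delta>) * (1 - \<delta> / 4) = 1 + 3 / 4 * \<delta> - \<delta> * \<delta> / 4" by (simp add: field_simps)
    ultimately show ?thesis by linarith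
  qed
  finally have B: "B \<le> 1 + \<delta>" using \<delta> by simp
  obtain w where w: "w \<in> Q" "L2_set (\<lambda>i. u i - w i) F \<le> \<delta> / 4" using net[OF u] by auto
  have "N w \<le> N u + N (\<lambda>i. w i - u i)" using tri[of u "\<lambda>i. w i - u i"] by simp
  also have "N (\<lambda>i. w i - u i) \<le> B * \<delta> / 4"
    using near[of w u] w Q u L2_set_minus_commute[of w u F] by auto
  finally have "1 - \<delta> / 2 - B * \<delta> / 4 \<le> N u" using NQ[OF w(1)] by simp
  \<comment> \<open>The crude bound B <= 2 suffices: \<delta>/2 + 2\<delta>/4 = \<delta>.\<close>
  moreover have "B * \<delta> \<le> 2 * \<delta>" using B \<delta> by (intro mult_right_mono) auto
  ultimately have "1 - \<delta> \<le> N u" by linarith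
  moreover have "N u \<le> 1 + \<delta>" using le_B[OF u] B by linarith
  ultimately show ?thesis
    unfolding Nx by (metis L2_set_nonneg mult.commute mult_right_mono)
qed

section \<open>Concentration of Gaussian matrices\<close>

abbreviation std_normal :: "real measure" where
  "std_normal \<equiv> density lborel std_normal_density"

interpretation std_normal: prob_space std_normal
  by (rule prob_space_normal_density) simp

interpretation PiM_std_normal: product_prob_space "\<lambda>_. std_normal" I for I :: "'i set"
  by unfold_locales

text \<open>Independence means that the joint law is the product of the marginal laws; both are the
  product measure itself.\<close>

lemma indep_vars_std_normal_components:
  assumes "I \<noteq> {}"
  shows "PiM_std_normal.indep_vars I (\<lambda>_. borel) (\<lambda>i X. X i) I"
proof -
  let ?M = "PiM I (\<lambda>_. std_normal)"
  have "distr ?M borel (\<lambda>X. X i) = std_normal" if "i \<in> I" for i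
    using PiM_std_normal.PiM_component[OF that] by (simp cong: distr_cong)
  then have "PiM I (\<lambda>i. distr ?M borel (\<lambda>X. X i)) = ?M"
    by (intro PiM_cong) auto
  moreover have "distr ?M (PiM I (\<lambda>_. borel)) (\<lambda>X. \<lambda>i\<in>I. X i) = ?M"
    by (rule trans[OF distr_cong distr_id]) (auto simp: space_PiM intro!: sets_PiM_cong)
  ultimately show ?thesis
    using assms by (subst PiM_std_normal.indep_vars_iff_distr_eq_PiM') auto
qed

lemma distributed_std_normal_component:
  assumes "i \<in> I"
  shows "distributed (PiM I (\<lambda>_. std_normal)) lborel (\<lambda>X. X i) std_normal_density"
proof -
  have "distr (PiM I (\<lambda>_. std_normal)) lborel (\<lambda>X. X i) = std_normal"
    using PiM_std_normal.PiM_component[OF assms] by (simp cong: distr_cong)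
  then show ?thesis using assms by (auto simp: distributed_def)
qed

text \<open>A sum of independent centred normals is normal and the variances add, here to 1.\<close>

lemma distributed_std_normal_linear:
  assumes I: "finite I" "K \<subseteq> I" and w: "(\<Sum>k\<in>K. (w k)\<^sup>2) = 1"
  shows "distributed (PiM I (\<lambda>_. std_normal)) lborel (\<lambda>X. \<Sum>k\<in>K. X k * w k) std_normal_density"
proof -
  let ?M = "PiM I (\<lambda>_. std_normal)"
  \<comment> \<open>Zero coefficients are dropped because they would give degenerate summands with
    standard deviation 0, which have no density.\<close>
  define S where "S = {k \<in> K. w k \<noteq> 0}"
  have S: "finite S" "S \<subseteq> I" using I by (auto simp: S_def intro: finite_subset)
  have fin: "finite K" using I by (auto intro: finite_subset)
  have sum_S: "(\<Sum>k\<in>S. (w k)\<^sup>2) = 1"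
    unfolding w[symmetric] S_def using fin by (intro sum.mono_neutral_left) auto
  then have "S \<noteq> {}" by auto
  have "PiM_std_normal.indep_vars I (\<lambda>_. borel) (\<lambda>k X. X k) S"
    using indep_vars_std_normal_components[of I] S \<open>S \<noteq> {}\<close>
    by (auto intro: PiM_std_normal.indep_vars_subset)
  then have "PiM_std_normal.indep_vars I (\<lambda>_. borel) (\<lambda>k X. X k * w k) S"
    by (rule PiM_std_normal.indep_vars_compose2) auto
  moreover have "distributed ?M lborel (\<lambda>X. X k * w k) (normal_density 0 \<bar>w k\<bar>)" if "k \<in> S" for k
    using PiM_std_normal.normal_density_affine[OF distributed_std_normal_component[of k I], of "w k" 0] that S
    by (auto simp: S_def mult.commute)
  ultimately have "distributed ?M lborel (\<lambda>X. \<Sum>k\<in>S. X k * w k)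
      (normal_density (\<Sum>k\<in>S. 0) (sqrt (\<Sum>k\<in>S. \<bar>w k\<bar>\<^sup>2)))"
    using S(1) \<open>S \<noteq> {}\<close> by (intro PiM_std_normal.sum_indep_normal) (auto simp: S_def)
  also have "(\<lambda>X. \<Sum>k\<in>S. X k * w k) = (\<lambda>X. \<Sum>k\<in>K. X k * w k)"
    unfolding S_def using fin by (intro ext sum.mono_neutral_left) auto
  finally show ?thesis by (simp add: sum_S)
qed

text \<open>The moment generating function of a squared standard normal, (1 - 2r)^(-1/2), at r = (1
  - 1/a^2)/2. With this parametrisation the integrand is \<open>a\<close> times the density of N(0,
  a^2).\<close>

lemma nn_integral_std_normal_exp_square:
  assumes a: "0 < a"
  shows "(\<integral>\<^sup>+x. ennreal (std_normal_density x) * ennreal (exp ((1 - 1 / a\<^sup>2) / 2 * x\<^sup>2)) \<partial>lborel) = ennreal a"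
proof -
  have "std_normal_density x * exp ((1 - 1 / a\<^sup>2) / 2 * x\<^sup>2) = a * normal_density 0 a x" for x
    using a by (simp add: normal_density_def real_sqrt_mult exp_add[symmetric] field_simps)
  then have "(\<integral>\<^sup>+x. ennreal (std_normal_density x) * ennreal (exp ((1 - 1 / a\<^sup>2) / 2 * x\<^sup>2)) \<partial>lborel)
      = (\<integral>\<^sup>+x. ennreal (a * normal_density 0 a x) \<partial>lborel)"
    by (simp add: ennreal_mult[symmetric])
  also have "\<dots> = ennreal a"
    using a by (subst nn_integral_eq_integral) (auto simp: normal_density_nonneg)
  finally show ?thesis .
qed

section \<open>The image of a unit vector under a Gaussian matrix\<close>

interpretation gaussian_matrix: prob_space "gaussian_matrix n p"
  unfolding gaussian_matrix_def by (rule PiM_std_normal.prob_space_axioms)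

lemma borel_measurable_matvec [measurable]:
  "i \<in> {1..n} \<Longrightarrow> (\<lambda>X. matvec p X \<beta> i) \<in> borel_measurable (gaussian_matrix n p)"
  unfolding matvec_def gaussian_matrix_def by measurable

text \<open>Summing over index pairs matches the index set of the product measure, so the results on
  Gaussian families apply to a row.\<close>

lemma matvec_eq_sum_row: "matvec p X \<beta> i = (\<Sum>k\<in>{i}\<times>{1..p}. X k * \<beta> (snd k))"
  unfolding matvec_def by (rule sum.reindex_bij_witness[where i=snd and j="Pair i"]) auto

lemma distributed_matvec:
  assumes "(\<Sum>j\<in>{1..p}. (u j)\<^sup>2) = 1" "i \<in> {1..n}"
  shows "distributed (gaussian_matrix n p) lborel (\<lambda>X. matvec p X u i) std_normal_density"
proof -
  have "(\<Sum>k\<in>{i}\<times>{1..p}. (u (snd k))\<^sup>2) = (\<Sum>j\<in>{1..p}. (u j)\<^sup>2)"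
    by (rule sum.reindex_bij_witness[where j=snd and i="Pair i"]) auto
  then show ?thesis
    unfolding matvec_eq_sum_row gaussian_matrix_def using assms
    by (intro distributed_std_normal_linear) auto
qed

text \<open>Different rows use disjoint blocks of independent entries.\<close>

lemma indep_vars_matvec:
  assumes "1 \<le> n" "1 \<le> p"
  shows "gaussian_matrix.indep_vars n p (\<lambda>_. borel) (\<lambda>i X. matvec p X u i) {1..n}"
proof -
  let ?I = "{1..n} \<times> {1..p}"
  have "PiM_std_normal.indep_vars ?I (\<lambda>i. PiM ({i} \<times> {1..p}) (\<lambda>_. borel))
      (\<lambda>i X. \<lambda>k\<in>{i} \<times> {1..p}. X k) {1..n}"
    using assms
    by (intro PiM_std_normal.indep_vars_restrict[OF indep_vars_std_normal_components[of ?I]])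
       (auto simp: disjoint_family_on_def)
  then have "PiM_std_normal.indep_vars ?I (\<lambda>_. borel)
      (\<lambda>i X. \<Sum>k\<in>{i} \<times> {1..p}. (\<lambda>k\<in>{i} \<times> {1..p}. X k) k * u (snd k)) {1..n}"
    by (rule PiM_std_normal.indep_vars_compose2) measurable
  then show ?thesis
    unfolding gaussian_matrix_def matvec_eq_sum_row by simp
qed

text \<open>The exponent \<open>(1 - 1 / a\<^sup>2) / 2\<close> optimises the Chernoff bound at threshold \<open>n * a\<^sup>2\<close>. It is
  positive for \<open>a > 1\<close> and negative for \<open>a < 1\<close>, so both tails are covered.\<close>

lemma gaussian_matrix_chernoff:
  assumes np: "1 \<le> n" "1 \<le> p" and u: "(\<Sum>j\<in>{1..p}. (u j)\<^sup>2) = 1" and a: "0 < a"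
  shows "measure (gaussian_matrix n p)
      {X \<in> space (gaussian_matrix n p).
        (1 - 1 / a\<^sup>2) / 2 * (n * a\<^sup>2) \<le> (1 - 1 / a\<^sup>2) / 2 * (\<Sum>i\<in>{1..n}. (matvec p X u i)\<^sup>2)}
    \<le> exp (- (n * (a - 1)\<^sup>2 / 2))"
proof -
  let ?M = "gaussian_matrix n p"
  define r where "r = (1 - 1 / a\<^sup>2) / 2"
  define S where "S X = (\<Sum>i\<in>{1..n}. (matvec p X u i)\<^sup>2)" for X
  define E where "E = {X \<in> space ?M. r * (n * a\<^sup>2) \<le> r * S X}"
  have [measurable]: "S \<in> borel_measurable ?M" unfolding S_def by measurable
  \<comment> \<open>By independence of the rows the moment generating function of the sum of squares
    factors into \<open>n\<close> equal integrals, each equal to \<open>a\<close>.\<close>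
  have "(\<integral>\<^sup>+X. ennreal (exp (r * S X)) \<partial>?M)
      = (\<integral>\<^sup>+X. (\<Prod>i\<in>{1..n}. ennreal (exp (r * (matvec p X u i)\<^sup>2))) \<partial>?M)"
    by (simp add: S_def sum_distrib_left exp_sum prod_ennreal)
  also have "\<dots> = (\<Prod>i\<in>{1..n}. \<integral>\<^sup>+X. ennreal (exp (r * (matvec p X u i)\<^sup>2)) \<partial>?M)"
    by (intro gaussian_matrix.indep_vars_nn_integral
        gaussian_matrix.indep_vars_compose2[OF indep_vars_matvec[OF np]]) auto
  also have "\<dots> = (\<Prod>i\<in>{1..n}. ennreal a)"
  proof (rule prod.cong)
    fix i assume "i \<in> {1..n}"
    then have "(\<integral>\<^sup>+X. ennreal (exp (r * (matvec p X u i)\<^sup>2)) \<partial>?M)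
        = (\<integral>\<^sup>+x. ennreal (std_normal_density x) * ennreal (exp (r * x\<^sup>2)) \<partial>lborel)"
      by (intro distributed_nn_integral[OF distributed_matvec[OF u], symmetric]) auto
    then show "(\<integral>\<^sup>+X. ennreal (exp (r * (matvec p X u i)\<^sup>2)) \<partial>?M) = ennreal a"
      using nn_integral_std_normal_exp_square[OF a] by (simp add: r_def)
  qed simp
  also have "\<dots> = ennreal (a ^ n)" using a by (simp add: ennreal_power)
  finally have mgf: "(\<integral>\<^sup>+X. ennreal (exp (r * S X)) \<partial>?M) = ennreal (a ^ n)" .
  \<comment> \<open>Exponential Markov inequality: on \<open>E\<close> the integrand on the right is
    at least 1.\<close>
  have "emeasure ?M E \<le> (\<integral>\<^sup>+X. ennreal (exp (- (r * (n * a\<^sup>2)))) * ennreal (exp (r * S X)) \<partial>?M)"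
  proof (subst nn_integral_indicator[symmetric])
    show "E \<in> sets ?M" unfolding E_def by measurable
    show "(\<integral>\<^sup>+X. indicator E X \<partial>?M)
        \<le> (\<integral>\<^sup>+X. ennreal (exp (- (r * (n * a\<^sup>2)))) * ennreal (exp (r * S X)) \<partial>?M)"
      by (intro nn_integral_mono)
         (auto simp: E_def indicator_def ennreal_mult[symmetric] exp_add[symmetric] simp flip: ennreal_1)
  qed
  also have "\<dots> = ennreal (exp (- (r * (n * a\<^sup>2))) * a ^ n)"
    using a by (subst nn_integral_cmult) (auto simp: mgf ennreal_mult)
  finally have "measure ?M E \<le> exp (- (r * (n * a\<^sup>2))) * a ^ n"
    using a by (simp add: gaussian_matrix.emeasure_eq_measure)
  also have "a ^ n = exp (n * ln a)" using a by (simp add: exp_of_nat_mult)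
  also have "exp (- (r * (n * a\<^sup>2))) * exp (n * ln a) = exp (n * (ln a - (a\<^sup>2 - 1) / 2))"
    using a by (simp add: r_def exp_add[symmetric] field_simps)
  \<comment> \<open>The inequality ln a <= a - 1 leaves the exponent (a - 1) - (a^2 - 1)/2, which is
    exactly -(a - 1)^2/2.\<close>
  also have "\<dots> \<le> exp (n * ((a - 1) - (a\<^sup>2 - 1) / 2))"
    using ln_le_minus_one[OF a] by (intro exp_le_cancel_iff[THEN iffD2] mult_left_mono) auto
  also have "n * ((a - 1) - (a\<^sup>2 - 1) / 2) = - (n * (a - 1)\<^sup>2 / 2)"
    by (simp add: power2_eq_square field_simps)
  finally show ?thesis by (simp add: E_def S_def r_def)
qed

text \<open>The lower tail is the Chernoff event at a = 1 - \<epsilon> and the upper tail the one at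
  a = 1 + \<epsilon>; both have (a - 1)^2 = \<epsilon>^2.\<close>

lemma gaussian_matrix_norm_concentration:
  assumes np: "1 \<le> n" "1 \<le> p" and u: "l2norm p u = 1" and e: "0 < \<epsilon>" "\<epsilon> < 1"
  shows "measure (gaussian_matrix n p)
      {X \<in> space (gaussian_matrix n p).
        \<not> (1 - \<epsilon> \<le> l2norm n (matvec p X u) / sqrt n \<and> l2norm n (matvec p X u) / sqrt n \<le> 1 + \<epsilon>)}
    \<le> 2 * exp (- (n * \<epsilon>\<^sup>2 / 2))"
proof -
  let ?M = "gaussian_matrix n p"
  define S where "S X = (\<Sum>i\<in>{1..n}. (matvec p X u i)\<^sup>2)" for X
  define E where "E a = {X \<in> space ?M. (1 - 1 / a\<^sup>2) / 2 * (n * a\<^sup>2) \<le> (1 - 1 / a\<^sup>2) / 2 * S X}" for a :: real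
  have [measurable]: "S \<in> borel_measurable ?M" unfolding S_def by measurable
  have E: "E a \<in> sets ?M" for a unfolding E_def by measurable
  have u': "(\<Sum>j\<in>{1..p}. (u j)\<^sup>2) = 1" using u by (simp add: l2norm_def)
  have pr: "measure ?M (E a) \<le> exp (- (n * (a - 1)\<^sup>2 / 2))" if "0 < a" for a :: real
    unfolding E_def S_def by (rule gaussian_matrix_chernoff[OF np u' that])
  have ratio: "l2norm n (matvec p X u) / sqrt n = sqrt (S X / n)" for X
    by (simp add: l2norm_def S_def real_sqrt_divide)
  have sub: "{X \<in> space ?M. \<not> (1 - \<epsilon> \<le> sqrt (S X / n) \<and> sqrt (S X / n) \<le> 1 + \<epsilon>)} \<subseteq> E (1 - \<epsilon>) \<union> E (1 + \<epsilon>)"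
  proof
    fix X assume "X \<in> {X \<in> space ?M. \<not> (1 - \<epsilon> \<le> sqrt (S X / n) \<and> sqrt (S X / n) \<le> 1 + \<epsilon>)}"
    then have X: "X \<in> space ?M" and "\<not> 1 - \<epsilon> \<le> sqrt (S X / n) \<or> \<not> sqrt (S X / n) \<le> 1 + \<epsilon>"
      by auto
    from this(2) show "X \<in> E (1 - \<epsilon>) \<union> E (1 + \<epsilon>)"
    proof
      assume "\<not> 1 - \<epsilon> \<le> sqrt (S X / n)"
      then have "S X / n \<le> (1 - \<epsilon>)\<^sup>2" using real_le_rsqrt[of "1 - \<epsilon>" "S X / n"] by linarith
      then have "S X \<le> n * (1 - \<epsilon>)\<^sup>2" using np by (simp add: field_simps)
      \<comment> \<open>A nonpositive factor reverses the inequality, so the lower tail of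
        \<open>S\<close> lands in \<open>E (1 - \<epsilon>)\<close>.\<close>
      moreover have "1 - 1 / (1 - \<epsilon>)\<^sup>2 \<le> 0" using e by (simp add: power_le_one)
      ultimately show ?thesis using X by (simp add: E_def mult_left_mono_neg)
    next
      assume "\<not> sqrt (S X / n) \<le> 1 + \<epsilon>"
      then have "(1 + \<epsilon>)\<^sup>2 \<le> S X / n" using real_le_lsqrt[of "1 + \<epsilon>" "S X / n"] e by linarith
      then have "n * (1 + \<epsilon>)\<^sup>2 \<le> S X" using np by (simp add: field_simps)
      moreover have "0 \<le> 1 - 1 / (1 + \<epsilon>)\<^sup>2" using e by simp
      ultimately show ?thesis using X by (simp add: E_def mult_left_mono)
    qed
  qed
  have "measure ?M {X \<in> space ?M. \<not> (1 - \<epsilon> \<le> sqrt (S X / n) \<and> sqrt (S X / n) \<le> 1 + \<epsilon>)}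
      \<le> measure ?M (E (1 - \<epsilon>) \<union> E (1 + \<epsilon>))"
    using E by (intro gaussian_matrix.finite_measure_mono sub) auto
  also have "\<dots> \<le> measure ?M (E (1 - \<epsilon>)) + measure ?M (E (1 + \<epsilon>))"
    using E by (intro measure_Un_le) auto
  also have "\<dots> \<le> 2 * exp (- (n * \<epsilon>\<^sup>2 / 2))"
    using pr[of "1 - \<epsilon>"] pr[of "1 + \<epsilon>"] e by simp
  finally show ?thesis by (simp add: ratio)
qed

section \<open>Simultaneous near-isometry\<close>

lemma l2norm_eq_L2_set: "l2norm p \<beta> = L2_set \<beta> {1..p}"
  by (simp add: l2norm_def L2_set_def)

lemma l2norm_eq_L2_set_support:
  assumes "F \<subseteq> {1..p}" "\<And>j. j \<notin> F \<Longrightarrow> \<beta> j = 0"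
  shows "l2norm p \<beta> = L2_set \<beta> F"
  unfolding l2norm_def L2_set_def using assms
  by (intro arg_cong[where f=sqrt] sum.mono_neutral_right) auto

lemma matvec_add: "matvec p X (\<lambda>j. x j + y j) = (\<lambda>i. matvec p X x i + matvec p X y i)"
  by (simp add: matvec_def fun_eq_iff algebra_simps sum.distrib)

lemma matvec_scale: "matvec p X (\<lambda>j. c * x j) = (\<lambda>i. c * matvec p X x i)"
  by (simp add: matvec_def fun_eq_iff sum_distrib_left algebra_simps)

text \<open>The requirement for a single coordinate subspace. The event of the theorem will be the
  intersection of these over all admissible \<open>F\<close>.\<close>

definition near_isometry_on :: "nat \<Rightarrow> nat \<Rightarrow> real \<Rightarrow> nat set \<Rightarrow> (nat \<times> nat \<Rightarrow> real) \<Rightarrow> bool" where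
  "near_isometry_on n p \<delta> F X \<longleftrightarrow> (\<forall>\<beta>. (\<forall>j. j \<notin> F \<longrightarrow> \<beta> j = 0) \<longrightarrow>
     (1 - \<delta>) * l2norm p \<beta> \<le> l2norm n (matvec p X \<beta>) / sqrt n \<and>
     l2norm n (matvec p X \<beta>) / sqrt n \<le> (1 + \<delta>) * l2norm p \<beta>)"

lemma near_isometry_on_empty: "near_isometry_on n p \<delta> {} X"
  by (simp add: near_isometry_on_def l2norm_def matvec_def)

lemma near_isometry_onI_net:
  assumes F: "F \<subseteq> {1..p}" and \<delta>: "0 < \<delta>" "\<delta> < 1"
    and Q: "Q \<subseteq> l2_sphere F"
    and net: "\<And>u. u \<in> l2_sphere F \<Longrightarrow> \<exists>v\<in>Q. L2_set (\<lambda>i. u i - v i) F \<le> \<delta> / 4"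
    and NQ: "\<And>u. u \<in> Q \<Longrightarrow> 1 - \<delta> / 2 \<le> l2norm n (matvec p X u) / sqrt n \<and>
               l2norm n (matvec p X u) / sqrt n \<le> 1 + \<delta> / 2"
  shows "near_isometry_on n p \<delta> F X"
proof -
  define N where "N \<beta> = l2norm n (matvec p X \<beta>) / sqrt n" for \<beta>
  have fin: "finite F" using F by (auto intro: finite_subset)
  have tri: "N (\<lambda>j. x j + y j) \<le> N x + N y" for x y
    using L2_set_triangle_ineq[of "matvec p X x" "matvec p X y" "{1..n}"]
    by (simp add: N_def l2norm_eq_L2_set matvec_add add_divide_distrib[symmetric] divide_right_mono)
  have hom: "N (\<lambda>j. c * x j) = \<bar>c\<bar> * N x" for c x
    by (simp add: N_def l2norm_def matvec_scale power_mult_distrib sum_distrib_left[symmetric] real_sqrt_mult)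
  \<comment> \<open>Any bound uniform in \<open>u\<close> serves; coordinates of a unit vector are
    at most 1 in modulus, so the sum of the absolute entries works.\<close>
  have bdd: "N u \<le> (\<Sum>i\<in>{1..n}. \<Sum>j\<in>{1..p}. \<bar>X (i, j)\<bar>) / sqrt n" if u: "u \<in> l2_sphere F" for u
  proof -
    have u1: "\<bar>u j\<bar> \<le> 1" for j
    proof (cases "j \<in> F")
      case True
      then have "\<bar>u j\<bar> \<le> L2_set (\<lambda>j. \<bar>u j\<bar>) F" using fin by (intro member_le_L2_set) auto
      then show ?thesis using u by (simp add: l2_sphere_def L2_set_def)
    qed (use u in \<open>simp add: l2_sphere_def\<close>)
    have "l2norm n (matvec p X u) \<le> (\<Sum>i\<in>{1..n}. \<bar>matvec p X u i\<bar>)"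
      unfolding l2norm_eq_L2_set by (rule L2_set_le_sum_abs)
    also have "\<dots> \<le> (\<Sum>i\<in>{1..n}. \<Sum>j\<in>{1..p}. \<bar>X (i, j)\<bar>)"
    proof (rule sum_mono)
      fix i
      have "\<bar>matvec p X u i\<bar> \<le> (\<Sum>j\<in>{1..p}. \<bar>X (i, j) * u j\<bar>)"
        unfolding matvec_def by (rule sum_abs)
      also have "\<dots> \<le> (\<Sum>j\<in>{1..p}. \<bar>X (i, j)\<bar>)"
        using u1 by (intro sum_mono) (simp add: abs_mult mult_left_le)
      finally show "\<bar>matvec p X u i\<bar> \<le> (\<Sum>j\<in>{1..p}. \<bar>X (i, j)\<bar>)" .
    qed
    finally show ?thesis unfolding N_def by (intro divide_right_mono) auto
  qed
  have "(1 - \<delta>) * L2_set x F \<le> N x \<and> N x \<le> (1 + \<delta>) * L2_set x F"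
    if "\<And>j. j \<notin> F \<Longrightarrow> x j = 0" for x
    by (rule near_isometry_from_net[where N=N and F=F and Q=Q, OF fin tri hom bdd \<delta> Q net])
       (use NQ that in \<open>auto simp: N_def\<close>)
  then show ?thesis
    using l2norm_eq_L2_set_support[OF F] by (auto simp: near_isometry_on_def N_def)
qed

section \<open>Measurability and probability of the event for one coordinate subspace\<close>

lemma borel_measurable_l2norm_matvec [measurable]:
  "(\<lambda>X. l2norm n (matvec p X \<beta>)) \<in> borel_measurable (gaussian_matrix n p)"
  unfolding l2norm_def by measurable

text \<open>The constraint is closed in \<^term>\<open>\<beta>\<close>, so it suffices to impose it on the countably many rational vectors.\<close>

lemma sets_near_isometry_on:
  assumes "finite F"
  shows "{X \<in> space (gaussian_matrix n p). near_isometry_on n p \<delta> F X} \<in> sets (gaussian_matrix n p)"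
proof -
  let ?M = "gaussian_matrix n p"
  define P where "P X \<beta> \<longleftrightarrow> (1 - \<delta>) * l2norm p \<beta> \<le> l2norm n (matvec p X \<beta>) / sqrt n \<and>
     l2norm n (matvec p X \<beta>) / sqrt n \<le> (1 + \<delta>) * l2norm p \<beta>" for X \<beta>
  \<comment> \<open>Rational on \<open>F\<close> and 0 elsewhere; countable because \<open>F\<close>
    is finite.\<close>
  define D :: "(nat \<Rightarrow> real) set" where "D = (\<lambda>f j. if j \<in> F then f j else 0) ` (Pi\<^sub>E F (\<lambda>_. \<rat>))"
  have D: "countable D"
    unfolding D_def by (intro countable_image countable_PiE assms countable_rat)
  have P: "P X \<beta>" if PD: "\<And>b. b \<in> D \<Longrightarrow> P X b" and \<beta>: "\<And>j. j \<notin> F \<Longrightarrow> \<beta> j = 0" for X \<beta>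
  proof -
    \<comment> \<open>Rational approximants of each coordinate, from above and within 1/(m+1). Off
      \<open>F\<close> they are replaced by 0 below, so that the approximating vectors stay in
      \<open>D\<close>.\<close>
    have "\<forall>m j. \<exists>r. r \<in> \<rat> \<and> \<beta> j < r \<and> r < \<beta> j + inverse (Suc m)"
      using Rats_dense_in_real[of "\<beta> j" "\<beta> j + inverse (Suc m)" for j m] by fastforce
    then obtain q where q: "\<And>j m. q m j \<in> \<rat>" "\<And>j m. \<beta> j < q m j" "\<And>j m. q m j < \<beta> j + inverse (Suc m)"
      unfolding choice_iff by blast
    define b where "b m j = (if j \<in> F then q m j else 0)" for m j
    have "b m = (\<lambda>j. if j \<in> F then restrict (q m) F j else 0)" for m
      by (auto simp: b_def)
    then have "b m \<in> D" for m
      unfolding D_def using q by (intro image_eqI[where x="restrict (q m) F"]) auto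
    then have Pb: "P X (b m)" for m by (rule PD)
    have "(\<lambda>m. b m j) \<longlonglongrightarrow> \<beta> j" for j
    proof (cases "j \<in> F")
      case True
      have "(\<lambda>m. \<beta> j + inverse (Suc m)) \<longlonglongrightarrow> \<beta> j + 0"
        by (rule tendsto_add[OF tendsto_const LIMSEQ_inverse_real_of_nat])
      then have upper: "(\<lambda>m. \<beta> j + inverse (Suc m)) \<longlonglongrightarrow> \<beta> j" by simp
      have "(\<lambda>m. q m j) \<longlonglongrightarrow> \<beta> j"
        by (rule tendsto_sandwich[OF _ _ tendsto_const upper])
           (simp_all add: q less_imp_le del: of_nat_Suc)
      with True show ?thesis by (simp add: b_def)
    qed (simp add: b_def \<beta>)
    note lim = this
    \<comment> \<open>Both norms depend continuously on finitely many coordinates, so the weak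
      inequalities survive the limit.\<close>
    have lim_l2: "(\<lambda>m. l2norm p (b m)) \<longlonglongrightarrow> l2norm p \<beta>"
      unfolding l2norm_def by (intro tendsto_intros lim)
    have lim_N: "(\<lambda>m. l2norm n (matvec p X (b m)) / sqrt n) \<longlonglongrightarrow> l2norm n (matvec p X \<beta>) / sqrt n"
      unfolding l2norm_def matvec_def divide_inverse by (intro tendsto_intros lim)
    have "(1 - \<delta>) * l2norm p \<beta> \<le> l2norm n (matvec p X \<beta>) / sqrt n"
      using Pb by (intro LIMSEQ_le[OF tendsto_mult_left[OF lim_l2] lim_N]) (auto simp: P_def)
    moreover have "l2norm n (matvec p X \<beta>) / sqrt n \<le> (1 + \<delta>) * l2norm p \<beta>"
      using Pb by (intro LIMSEQ_le[OF lim_N tendsto_mult_left[OF lim_l2]]) (auto simp: P_def)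
    ultimately show ?thesis by (simp add: P_def)
  qed
  have "{X \<in> space ?M. near_isometry_on n p \<delta> F X} = {X \<in> space ?M. \<forall>\<beta>\<in>D. P X \<beta>}"
  proof (intro Collect_cong conj_cong refl iffI)
    fix X assume "near_isometry_on n p \<delta> F X"
    then show "\<forall>\<beta>\<in>D. P X \<beta>" by (auto simp: D_def near_isometry_on_def P_def)
  next
    fix X assume "\<forall>\<beta>\<in>D. P X \<beta>"
    then have "P X \<beta>" if "\<And>j. j \<notin> F \<Longrightarrow> \<beta> j = 0" for \<beta> using P that by blast
    then show "near_isometry_on n p \<delta> F X" by (auto simp: near_isometry_on_def P_def)
  qed
  also have "\<dots> \<in> sets ?M"
    unfolding P_def by (intro sets.sets_Collect_countable_All' D) measurable
  finally show ?thesis .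
qed

text \<open>Union bound over a net of mesh \<delta>/4, with deviation \<epsilon> = \<delta>/2 at
  each net point: 1 + 2/(\<delta>/4) = 1 + 8/\<delta> and \<epsilon>^2/2 = \<delta>^2/8.\<close>

lemma prob_not_near_isometry_on_le:
  assumes F: "F \<subseteq> {1..p}" "F \<noteq> {}" and n: "1 \<le> n" and \<delta>: "0 < \<delta>" "\<delta> < 1"
  shows "measure (gaussian_matrix n p) {X \<in> space (gaussian_matrix n p). \<not> near_isometry_on n p \<delta> F X}
    \<le> 2 * (1 + 8 / \<delta>) ^ card F * exp (- (n * \<delta>\<^sup>2 / 8))"
proof -
  let ?M = "gaussian_matrix n p"
  define E where "E u = {X \<in> space ?M. \<not> (1 - \<delta> / 2 \<le> l2norm n (matvec p X u) / sqrt n \<and>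
    l2norm n (matvec p X u) / sqrt n \<le> 1 + \<delta> / 2)}" for u
  have E: "E u \<in> sets ?M" for u unfolding E_def by measurable
  have fin: "finite F" using F by (auto intro: finite_subset)
  have p: "1 \<le> p" using F by (cases p) auto
  obtain Q where Q: "finite Q" "Q \<subseteq> l2_sphere F" "real (card Q) \<le> (1 + 2 / (\<delta> / 4)) ^ card F"
    and net: "\<And>u. u \<in> l2_sphere F \<Longrightarrow> \<exists>v\<in>Q. L2_set (\<lambda>i. u i - v i) F \<le> \<delta> / 4"
    using l2_sphere_net[OF fin, of "\<delta> / 4"] \<delta> by auto
  have "{X \<in> space ?M. \<not> near_isometry_on n p \<delta> F X} \<subseteq> (\<Union>u\<in>Q. E u)"
    using near_isometry_onI_net[OF F(1) \<delta> Q(2) net] by (auto simp: E_def)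
  then have "measure ?M {X \<in> space ?M. \<not> near_isometry_on n p \<delta> F X} \<le> measure ?M (\<Union>u\<in>Q. E u)"
    using E Q by (intro gaussian_matrix.finite_measure_mono) auto
  also have "\<dots> \<le> (\<Sum>u\<in>Q. measure ?M (E u))"
    using E Q by (intro gaussian_matrix.finite_measure_subadditive_finite) auto
  also have "\<dots> \<le> (\<Sum>u\<in>Q. 2 * exp (- (n * (\<delta> / 2)\<^sup>2 / 2)))"
  proof (rule sum_mono)
    fix u assume "u \<in> Q"
    then have "u \<in> l2_sphere F" using Q by auto
    then have "l2norm p u = 1"
      using l2norm_eq_L2_set_support[OF F(1), of u] by (simp add: l2_sphere_def)
    then show "measure ?M (E u) \<le> 2 * exp (- (n * (\<delta> / 2)\<^sup>2 / 2))"
      unfolding E_def using \<delta> by (intro gaussian_matrix_norm_concentration n p) auto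
  qed
  also have "\<dots> = card Q * (2 * exp (- (n * \<delta>\<^sup>2 / 8)))"
    by (simp add: power_divide)
  also have "\<dots> \<le> (1 + 8 / \<delta>) ^ card F * (2 * exp (- (n * \<delta>\<^sup>2 / 8)))"
    using Q(3) by (intro mult_right_mono) auto
  finally show ?thesis by simp
qed

text \<open>The minimum over a finite nonempty family is attained. This turns the quantifier over
  vectors of small complexity into one over finitely many coordinate subspaces.\<close>

lemma coding_complexity_le_iff:
  assumes "\<And>j. j \<notin> {1..p} \<Longrightarrow> \<beta> j = 0"
  shows "coding_complexity p cl \<beta> \<le> s \<longleftrightarrow>
    (\<exists>F\<subseteq>{1..p}. (\<forall>j. j \<notin> F \<longrightarrow> \<beta> j = 0) \<and> coding_complexity_set cl F \<le> s)"
proof -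
  have "finite {F. F \<subseteq> {1..p} \<and> supp p \<beta> \<subseteq> F}" "{1..p} \<in> {F. F \<subseteq> {1..p} \<and> supp p \<beta> \<subseteq> F}"
    by (auto simp: supp_def)
  then have "coding_complexity p cl \<beta> \<le> s \<longleftrightarrow>
      (\<exists>F\<subseteq>{1..p}. supp p \<beta> \<subseteq> F \<and> coding_complexity_set cl F \<le> s)"
    unfolding coding_complexity_def by (subst Min_le_iff) auto
  moreover have "supp p \<beta> \<subseteq> F \<longleftrightarrow> (\<forall>j. j \<notin> F \<longrightarrow> \<beta> j = 0)" for F
    using assms by (auto simp: supp_def)
  ultimately show ?thesis by simp
qed

theorem theorem1:
  fixes n p :: nat and cl :: "nat set \<Rightarrow> ereal" and s t \<delta> :: real
  assumes "coding_length p cl"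
    and "s > 0" and "t > 0" and "0 < \<delta>" and "\<delta> < 1"
    and "real n \<ge> 8 / \<delta>\<^sup>2 * (ln 3 + t + s * ln (1 + 8 / \<delta>))"
  shows "measure (gaussian_matrix n p)
           {X \<in> space (gaussian_matrix n p).
              \<forall>\<beta>. (\<forall>j. j \<notin> {1..p} \<longrightarrow> \<beta> j = 0) \<longrightarrow> coding_complexity p cl \<beta> \<le> ereal s \<longrightarrow>
                (1 - \<delta>) * l2norm p \<beta> \<le> l2norm n (matvec p X \<beta>) / sqrt (real n) \<and>
                l2norm n (matvec p X \<beta>) / sqrt (real n) \<le> (1 + \<delta>) * l2norm p \<beta>}
         \<ge> 1 - exp (- t)" (is "measure ?M ?G \<ge> _")
proof -
  define L where "L = 1 + 8 / \<delta>"
  have L: "2 \<le> L" using assms by (simp add: L_def field_simps)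
  \<comment> \<open>The empty set is left out to match the coding sum; near-isometry on it is
    trivial.\<close>
  define \<F> where "\<F> = {F. F \<subseteq> {1..p} \<and> F \<noteq> {} \<and> coding_complexity_set cl F \<le> ereal s}"
  define w where "w F = (if cl F = \<infinity> then 0 else (2::real) powr (- real_of_ereal (cl F)))" for F
  define B where "B F = {X \<in> space ?M. \<not> near_isometry_on n p \<delta> F X}" for F
  have fin: "finite \<F>" unfolding \<F>_def by (rule finite_subset[of _ "Pow {1..p}"]) auto
  have B: "B F \<in> sets ?M" if "F \<in> \<F>" for F
  proof -
    have "finite F" using that by (auto simp: \<F>_def intro: finite_subset)
    moreover have "B F = space ?M - {X \<in> space ?M. near_isometry_on n p \<delta> F X}"
      by (auto simp: B_def)
    ultimately show ?thesis using sets_near_isometry_on by auto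
  qed
  have "8 / \<delta>\<^sup>2 * (ln 3 + t + s * ln L) > 0"
    using assms L by (intro mult_pos_pos add_pos_pos) auto
  then have n: "1 \<le> n" using assms(6) unfolding L_def by (cases n) auto
  have "ln 3 + t + s * ln L \<le> n * \<delta>\<^sup>2 / 8"
    using assms(4,6) by (simp add: L_def field_simps)
  then have "exp (- (n * \<delta>\<^sup>2 / 8)) \<le> exp (- ln 3 - t - s * ln L)" by simp
  also have "\<dots> = exp (- t) * L powr (- s) / 3"
    using L by (simp add: powr_def exp_diff exp_minus field_simps exp_add[symmetric])
  finally have "3 * exp (- (n * \<delta>\<^sup>2 / 8)) \<le> exp (- t) * L powr (- s)" by simp
  \<comment> \<open>The term ln 3 in the hypothesis yields a factor 3, which covers the factor 2
    from the two tails.\<close>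
  then have tail: "2 * exp (- (n * \<delta>\<^sup>2 / 8)) \<le> exp (- t) * L powr (- s)"
    using exp_ge_zero[of "- (n * \<delta>\<^sup>2 / 8)"] by linarith
  have prob_B: "measure ?M (B F) \<le> exp (- t) * w F" if "F \<in> \<F>" for F
  proof -
    have F: "F \<subseteq> {1..p}" "F \<noteq> {}" and c: "ereal (card F) + cl F \<le> ereal s"
      using that by (auto simp: \<F>_def coding_complexity_set_def)
    have "0 \<le> cl F" using assms(1) F by (auto simp: coding_length_def)
    \<comment> \<open>Complexity at most the real number \<open>s\<close> forces \<open>cl F\<close>
      to be finite, so \<open>w F\<close> is 2^(-k).\<close>
    then obtain k :: real where k: "cl F = ereal k" "0 \<le> k" "card F + k \<le> s"
      using c by (cases "cl F") auto
    have "measure ?M (B F) \<le> L ^ card F * (2 * exp (- (n * \<delta>\<^sup>2 / 8)))"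
      using prob_not_near_isometry_on_le[OF F n assms(4,5)] by (simp add: B_def L_def mult_ac)
    also have "\<dots> \<le> L ^ card F * (exp (- t) * L powr (- s))"
      using L tail by (intro mult_left_mono) auto
    also have "\<dots> = exp (- t) * L powr (card F - s)"
      using L by (simp add: powr_diff powr_minus powr_realpow divide_inverse)
    \<comment> \<open>First |F| + k <= s lowers the exponent to -k; then L >= 2 and k >= 0 allow the
      base 2 of the coding condition.\<close>
    also have "L powr (card F - s) \<le> L powr (- k)"
      using L k by (intro powr_mono) auto
    also have "L powr (- k) \<le> 2 powr (- k)"
      using L k by (intro powr_mono2') auto
    finally show ?thesis by (simp add: w_def k)
  qed
  \<comment> \<open>Each vector of complexity at most \<open>s\<close> lies in some admissible
    subspace, and conversely every vector supported in a member of \<open>\<F>\<close> has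
    complexity at most \<open>s\<close>.\<close>
  have "(\<Union>F\<in>\<F>. B F) = space ?M - ?G"
  proof -
    have "?G = {X \<in> space ?M. \<forall>F\<in>\<F>. near_isometry_on n p \<delta> F X}"
    proof (intro Collect_cong conj_cong refl iffI ballI allI impI)
      fix X F assume *: "\<forall>\<beta>. (\<forall>j. j \<notin> {1..p} \<longrightarrow> \<beta> j = 0) \<longrightarrow> coding_complexity p cl \<beta> \<le> ereal s \<longrightarrow>
                (1 - \<delta>) * l2norm p \<beta> \<le> l2norm n (matvec p X \<beta>) / sqrt (real n) \<and>
                l2norm n (matvec p X \<beta>) / sqrt (real n) \<le> (1 + \<delta>) * l2norm p \<beta>" and F: "F \<in> \<F>"
      show "near_isometry_on n p \<delta> F X"
        unfolding near_isometry_on_def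
      proof (intro allI impI)
        fix \<beta> assume \<beta>: "\<forall>j. j \<notin> F \<longrightarrow> \<beta> j = (0::real)"
        have "\<forall>j. j \<notin> {1..p} \<longrightarrow> \<beta> j = 0" using \<beta> F by (auto simp: \<F>_def)
        moreover from this have "coding_complexity p cl \<beta> \<le> ereal s"
          using \<beta> F by (subst coding_complexity_le_iff) (auto simp: \<F>_def)
        ultimately show "(1 - \<delta>) * l2norm p \<beta> \<le> l2norm n (matvec p X \<beta>) / sqrt (real n) \<and>
                l2norm n (matvec p X \<beta>) / sqrt (real n) \<le> (1 + \<delta>) * l2norm p \<beta>"
          using * by blast
      qed
    next
      fix X \<beta> assume *: "\<forall>F\<in>\<F>. near_isometry_on n p \<delta> F X"
        and \<beta>: "\<forall>j. j \<notin> {1..p} \<longrightarrow> \<beta> j = 0" "coding_complexity p cl \<beta> \<le> ereal s"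
      then obtain F where F: "F \<subseteq> {1..p}" "\<forall>j. j \<notin> F \<longrightarrow> \<beta> j = 0" "coding_complexity_set cl F \<le> ereal s"
        using coding_complexity_le_iff[of p \<beta> cl "ereal s"] by auto
      then have "near_isometry_on n p \<delta> F X"
        using * near_isometry_on_empty by (cases "F = {}") (auto simp: \<F>_def)
      then show "(1 - \<delta>) * l2norm p \<beta> \<le> l2norm n (matvec p X \<beta>) / sqrt (real n) \<and>
                l2norm n (matvec p X \<beta>) / sqrt (real n) \<le> (1 + \<delta>) * l2norm p \<beta>"
        using F(2) by (simp add: near_isometry_on_def)
    qed
    then show ?thesis by (auto simp: B_def)
  qed
  then have G: "?G = space ?M - (\<Union>F\<in>\<F>. B F)" by auto
  have "measure ?M (\<Union>F\<in>\<F>. B F) \<le> (\<Sum>F\<in>\<F>. measure ?M (B F))"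
    using B fin by (intro gaussian_matrix.finite_measure_subadditive_finite) auto
  also have "\<dots> \<le> (\<Sum>F\<in>\<F>. exp (- t) * w F)"
    by (intro sum_mono prob_B)
  \<comment> \<open>Weights are nonnegative, so the sum may be extended to all nonempty subsets,
    where the coding length condition bounds it.\<close>
  also have "\<dots> \<le> (\<Sum>F\<in>{F. F \<subseteq> {1..p} \<and> F \<noteq> {}}. exp (- t) * w F)"
    by (intro sum_mono2) (auto simp: \<F>_def w_def)
  also have "\<dots> \<le> exp (- t)"
    using assms(1) by (simp add: coding_length_def w_def sum_distrib_left[symmetric])
  finally show ?thesis
    unfolding G using B fin by (subst gaussian_matrix.prob_compl) auto
qed

end
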